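(* Let $S$ be a semigroup and let $\sigma:S\to S$ be an automorphism (not necessarily involutive). The functional equations $$f(x\sigma(y))=f(x)g(y)+f(y)g(x),\quad x,y\in S,$$ and $$f(\sigma(y)x)=f(x)g(y)+f(y)g(x),\quad x,y\in S,$$ for unknown functions $f,g:S\to\mathbb{C}$, have the same solutions $(f,g)$.
   Context: A semigroup is a set with an associative binary operation. An automorphism $\sigma:S\to S$ is a bijection with $\sigma(xy)=\sigma(x)\sigma(y)$ for all $x,y\in S$. *)

theory Defs
  imports Complex_Main
begin

definition semigroup_automorphism :: "('a::semigroup_mult \<Rightarrow> 'a) \<Rightarrow> bool" where
  "semigroup_automorphism \<sigma> \<longleftrightarrow> bij \<sigma> \<and> (\<forall>x y. \<sigma> (x * y) = \<sigma> x * \<sigma> y)"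

end

theory Submission
  imports Defs
begin

text \<open>
  Both equations have the same right-hand side, so they are equivalent for a pair \<open>(f, g)\<close> as soon
  as each of them forces \<open>f\<close> to be central, meaning \<open>f (x * y) = f (y * x)\<close>.  The second equation on
  a semigroup is the first one on the opposite semigroup, hence it suffices to derive centrality
  from the first equation for an arbitrary associative operation \<open>m\<close>.

  If \<open>g = c f\<close>, the equation reads \<open>f (x \<sigma>(y)) = 2c f(x) f(y)\<close>, and \<open>2c f\<close> turns out to be
  multiplicative, unless it vanishes, in which case \<open>f\<close> vanishes on all products
  (\<open>central_if_proportional\<close>).

  If \<open>f\<close> and \<open>g\<close> are linearly independent, expanding \<open>f (x \<sigma>(yz))\<close> in two ways shows that the span
  of \<open>f\<close> and \<open>g\<close> is invariant under right translations.  Comparing coefficients of \<open>f\<close> and \<open>g\<close>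
  then determines the matrices of these translations, and one finds the ordinary sine addition law
  \<open>f (yz) = f(y) g(z) + g(y) f(z)\<close>, whose right-hand side is symmetric (\<open>sine_law_if_independent\<close>).
\<close>

text \<open>
  Splitting \<open>f (x \<sigma>(y) \<sigma>(z))\<close> as \<open>x \<cdot> \<sigma>(yz)\<close> and as \<open>(x \<sigma>(y)) \<cdot> \<sigma>(z)\<close> yields
  \<open>k f(x) f(yz) = k\<^sup>2 f(x) f(y) f(z)\<close>, which expresses \<open>f (yz)\<close> symmetrically in \<open>y\<close> and \<open>z\<close> once
  \<open>k\<close> and one value of \<open>f\<close> can be cancelled.
\<close>
lemma central_if_proportional:
  fixes m :: "'a \<Rightarrow> 'a \<Rightarrow> 'a" and f :: "'a \<Rightarrow> 'b::field"
  assumes assoc: "\<And>x y z. m (m x y) z = m x (m y z)"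
    and hom: "\<And>x y. \<sigma> (m x y) = m (\<sigma> x) (\<sigma> y)"
    and surj: "surj \<sigma>"
    and eq: "\<And>x y. f (m x (\<sigma> y)) = k * f x * f y"
  shows "f (m y z) = f (m z y)"
proof (cases "k = 0 \<or> (\<forall>x. f x = 0)")
  case True
  have "f (m u v) = 0" for u v
  proof -
    obtain w where "v = \<sigma> w" using surj by blast
    then show ?thesis using True eq[of u w] by auto
  qed
  then show ?thesis by simp
next
  case False
  then obtain x where x: "k \<noteq> 0" "f x \<noteq> 0" by blast
  have "f (m u v) = k * f u * f v" for u v
  proof -
    have "k * f x * f (m u v) = f (m (m x (\<sigma> u)) (\<sigma> v))"
      by (simp add: assoc eq flip: hom)
    also have "\<dots> = k * f x * (k * f u * f v)"
      by (simp add: eq mult.assoc)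
    finally show ?thesis using x by simp
  qed
  then show ?thesis by (simp add: mult.commute mult.left_commute)
qed

text \<open>
  Independence lets every identity between combinations of \<open>f\<close> and \<open>g\<close> be read off coordinatewise.
  The translates \<open>f (y \<sigma>(z))\<close> and \<open>g (y \<sigma>(z))\<close> have coordinates in terms of \<open>f z\<close> and \<open>g z\<close>, and
  also, from the formulas for \<open>f (yz)\<close> and \<open>g (yz)\<close>, in terms of \<open>f (\<sigma> z)\<close> and \<open>g (\<sigma> z)\<close>.  Their
  agreement forces \<open>f \<circ> \<sigma> = f\<close> and \<open>g \<circ> \<sigma> = g\<close>, so that \<open>\<sigma>\<close> drops out of the equation; the last
  step cancels a factor \<open>2\<close>.
\<close>
lemma sine_law_if_independent:
  fixes m :: "'a \<Rightarrow> 'a \<Rightarrow> 'a" and f g :: "'a \<Rightarrow> 'b::field_char_0"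
  assumes assoc: "\<And>x y z. m (m x y) z = m x (m y z)"
    and hom: "\<And>x y. \<sigma> (m x y) = m (\<sigma> x) (\<sigma> y)"
    and surj: "surj \<sigma>"
    and eq: "\<And>x y. f (m x (\<sigma> y)) = f x * g y + f y * g x"
    and indep: "\<And>a b. (\<And>x. a * f x + b * g x = 0) \<Longrightarrow> a = 0 \<and> b = 0"
  shows "f (m y z) = f y * g z + g y * f z"
proof -
  have coeffs: "a = a' \<and> b = b'" if "\<And>x. a * f x + b * g x = a' * f x + b' * g x" for a b a' b'
    using indep[of "a - a'" "b - b'"] that by (simp add: algebra_simps)
  obtain z0 where z0: "f z0 \<noteq> 0"
    using indep[of 1 0] by auto
  obtain w0 where w0: "\<sigma> w0 = z0"
    using surj by (metis surjD)
  have two_ways: "g (m y z) * f x + f (m y z) * g x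
      = (f x * g y + f y * g x) * g z + f z * g (m x (\<sigma> y))" for x y z
  proof -
    have "f (m x (\<sigma> (m y z))) = f (m (m x (\<sigma> y)) (\<sigma> z))"
      by (simp add: hom assoc)
    then show ?thesis by (simp add: eq algebra_simps)
  qed
  \<comment> \<open>Solving \<open>two_ways\<close> for \<open>g (x \<sigma>(y))\<close> at \<open>z = z0\<close> gives the coordinates \<open>A y\<close>, \<open>B y\<close> of the
    right translate of \<open>g\<close> by \<open>\<sigma> y\<close>.\<close>
  define A where "A y = (g (m y z0) - g y * g z0) / f z0" for y
  define B where "B y = (f (m y z0) - f y * g z0) / f z0" for y
  have g_right: "g (m x (\<sigma> y)) = A y * f x + B y * g x" for x y
  proof -
    have "f z0 * g (m x (\<sigma> y)) = (g (m y z0) - g y * g z0) * f x + (f (m y z0) - f y * g z0) * g x"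
      using two_ways[of y z0 x] by (simp add: algebra_simps)
    also have "\<dots> = f z0 * (A y * f x + B y * g x)"
      using z0 by (simp add: A_def B_def distrib_left)
    finally show ?thesis using z0 by simp
  qed
  have "g (m y z) = g y * g z + A y * f z \<and> f (m y z) = f y * g z + B y * f z" for y z
    using two_ways[of y z] by (intro coeffs) (simp add: g_right algebra_simps)
  then have g_mult: "g (m y z) = g y * g z + A y * f z"
    and f_mult: "f (m y z) = f y * g z + B y * f z" for y z
    by auto
  \<comment> \<open>\<open>A\<close> and \<open>B\<close> lie in the span of \<open>f\<close> and \<open>g\<close>, because \<open>z0 = \<sigma> w0\<close> and translates by values
    of \<open>\<sigma>\<close> do.\<close>
  obtain \<alpha> \<beta> where B: "\<And>y. B y = \<alpha> * f y + \<beta> * g y"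
  proof
    show "B y = ((g w0 - g z0) / f z0) * f y + (f w0 / f z0) * g y" for y
      using eq[of y w0] z0 by (simp add: B_def w0 field_simps)
  qed
  obtain \<gamma> \<delta> where A: "\<And>y. A y = \<gamma> * f y + \<delta> * g y"
  proof
    show "A y = (A w0 / f z0) * f y + ((B w0 - g z0) / f z0) * g y" for y
      using g_right[of y w0] g_mult[of y z0] z0 by (simp add: w0 field_simps)
  qed
  \<comment> \<open>Each right translate by \<open>\<sigma> z\<close> is now known in two ways; compare coordinates.\<close>
  have "g (\<sigma> z) + \<alpha> * f (\<sigma> z) = g z \<and> \<beta> * f (\<sigma> z) = f z" for z
    by (rule coeffs) (use eq[of _ z] f_mult[of _ "\<sigma> z"] in \<open>simp add: B algebra_simps\<close>)
  then have f1: "g (\<sigma> z) = g z - \<alpha> * f (\<sigma> z)" and f2: "\<beta> * f (\<sigma> z) = f z" for z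
    by (simp_all add: eq_diff_eq)
  have g12: "\<gamma> * f (\<sigma> z) = A z \<and> g (\<sigma> z) + \<delta> * f (\<sigma> z) = B z" for z
    by (rule coeffs) (use g_right[of _ z] g_mult[of _ "\<sigma> z"] in \<open>simp add: A algebra_simps\<close>)
  have "\<beta> \<noteq> 0" using f2[of z0] z0 by auto
  then have f\<sigma>: "f (\<sigma> z) = f z / \<beta>" for z
    using f2[of z] by (simp add: field_simps)
  have "\<gamma> / \<beta> = \<gamma> \<and> 0 = \<delta>"
    by (rule coeffs) (use g12 in \<open>simp add: f\<sigma> A\<close>)
  then have "\<delta> = 0" by simp
  then have "- \<alpha> / \<beta> = \<alpha> \<and> 1 = \<beta>"
    by (intro coeffs) (use g12 in \<open>simp add: f1 f\<sigma> B\<close>)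
  then have "\<beta> = 1" "\<alpha> = 0" by auto
  then show ?thesis by (simp add: f_mult B)
qed

lemma central_if_sine_law:
  fixes m :: "'a \<Rightarrow> 'a \<Rightarrow> 'a" and f g :: "'a \<Rightarrow> 'b::field_char_0"
  assumes assoc: "\<And>x y z. m (m x y) z = m x (m y z)"
    and hom: "\<And>x y. \<sigma> (m x y) = m (\<sigma> x) (\<sigma> y)"
    and surj: "surj \<sigma>"
    and eq: "\<And>x y. f (m x (\<sigma> y)) = f x * g y + f y * g x"
  shows "f (m y z) = f (m z y)"
proof (cases "\<exists>c. \<forall>x. g x = c * f x")
  case True
  then obtain c where "\<And>x. g x = c * f x" by blast
  then have "f (m x (\<sigma> y)) = 2 * c * f x * f y" for x y
    by (simp add: eq)
  with assoc hom surj show ?thesis by (rule central_if_proportional)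
next
  case False
  show ?thesis
  proof (cases "\<forall>x. f x = 0")
    case f: False
    have "a = 0 \<and> b = 0" if ab: "\<And>x. a * f x + b * g x = 0" for a b
    proof -
      have "b = 0"
      proof (rule ccontr)
        assume "b \<noteq> 0"
        then have "g x = (- a / b) * f x" for x
          using ab[of x] by (simp add: field_simps add_eq_0_iff)
        with False show False by blast
      qed
      with ab f show ?thesis by auto
    qed
    from sine_law_if_independent[of m \<sigma> f g, OF assoc hom surj eq this]
    have "f (m u v) = f u * g v + g u * f v" for u v
      by blast
    then show ?thesis by (simp add: mult.commute)
  qed simp
qed

theorem proposition4p4:
  fixes \<sigma> :: "'a::semigroup_mult \<Rightarrow> 'a"
  assumes "semigroup_automorphism \<sigma>"
  shows "{(f :: 'a \<Rightarrow> complex, g :: 'a \<Rightarrow> complex).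
            \<forall>x y. f (x * \<sigma> y) = f x * g y + f y * g x}
       = {(f :: 'a \<Rightarrow> complex, g :: 'a \<Rightarrow> complex).
            \<forall>x y. f (\<sigma> y * x) = f x * g y + f y * g x}"
proof -
  have hom: "\<sigma> (x * y) = \<sigma> x * \<sigma> y" and surj: "surj \<sigma>" for x y
    using assms by (auto simp: semigroup_automorphism_def bij_is_surj)
  have "(\<forall>x y. f (x * \<sigma> y) = f x * g y + f y * g x) \<longleftrightarrow>
        (\<forall>x y. f (\<sigma> y * x) = f x * g y + f y * g x)" (is "?right \<longleftrightarrow> ?left")
    for f g :: "'a \<Rightarrow> complex"
  proof
    assume eq: ?right
    have "f (x * y) = f (y * x)" for x y
      by (rule central_if_sine_law[of "(*)" \<sigma> f g]) (use eq hom surj in \<open>auto simp: mult.assoc\<close>)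
    with eq show ?left by simp
  next
    assume eq: ?left
    have "f (x * y) = f (y * x)" for x y
      by (rule central_if_sine_law[of "\<lambda>u v. v * u" \<sigma> f g])
        (use eq hom surj in \<open>auto simp: mult.assoc\<close>)
    with eq show ?right by simp
  qed
  then show ?thesis by simp
qed

end
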